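(* Let $\mathbb{K}$ be an infinite field with $\mathrm{char}\,\mathbb{K}=2$, let $r\ge 4$ and $\alpha\ge 5$ be integers, let $R=\mathbb{K}[x_1,\dots,x_r]$, and let $J\subset R$ be the monomial ideal generated by the powers $x_i^{\alpha}$ for $1\le i\le r$ together with the monomials $x_i^{\alpha-2}x_j^{2}$ and $x_i^{2}x_j^{\alpha-2}$ for all $1\le i<j\le r$. Then $R/J$ does not have the weak Lefschetz property.
   Context: The ring $R=\mathbb{K}[x_1,\dots,x_r]$ has the standard grading. A standard graded Artinian $\mathbb{K}$-algebra $A=R/J=\bigoplus_{i=0}^e A_i$ (with $J$ a homogeneous ideal, $A_e\neq 0$) has the weak Lefschetz property (WLP) if there exists a linear form $\ell\in R_1$ such that for every $0\le i\le e-1$ the multiplication map $\times\ell: A_i\to A_{i+1}$ has maximal rank, i.e. is injective or surjective. *)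

theory Defs
  imports
    "HOL-Library.Poly_Mapping"
    "HOL-Algebra.QuotRing"
    "HOL-Algebra.Algebraic_Closure_Type"
begin

text \<open>
  The polynomial ring over a coefficient type \<open>'k\<close>, with variables indexed by the type \<open>'n\<close>:
  finitely supported functions from exponent vectors to coefficients, whose product in
  \<^theory>\<open>HOL-Library.Poly_Mapping\<close> is the convolution. For finite \<open>'n\<close> it is the polynomial ring
  in \<open>CARD('n)\<close> variables.
\<close>

type_synonym ('n, 'k) mpoly_ring = "('n \<Rightarrow>\<^sub>0 nat) \<Rightarrow>\<^sub>0 'k"

definition var :: "'n \<Rightarrow> ('n, 'k::field) mpoly_ring" where
  "var i = Poly_Mapping.single (Poly_Mapping.single i 1) 1"

definition homogeneous_part :: "nat \<Rightarrow> ('n::finite, 'k::field) mpoly_ring set" where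
  "homogeneous_part d =
     {f. \<forall>m \<in> Poly_Mapping.keys f. (\<Sum>i\<in>UNIV. Poly_Mapping.lookup m i) = d}"

abbreviation poly_ring :: "('n, 'k::field) mpoly_ring ring" where
  "poly_ring \<equiv> ring_of_type_algebra"

abbreviation quotient_algebra ::
    "('n, 'k::field) mpoly_ring set \<Rightarrow> ('n, 'k) mpoly_ring set ring" where
  "quotient_algebra J \<equiv> poly_ring Quot J"

definition residue_class ::
    "('n, 'k::field) mpoly_ring set \<Rightarrow> ('n, 'k) mpoly_ring \<Rightarrow> ('n, 'k) mpoly_ring set" where
  "residue_class J f = J +>\<^bsub>poly_ring\<^esub> f"

text \<open>The component \<open>A\<^sub>d\<close> of \<open>A = R/J\<close>, for a homogeneous ideal \<open>J\<close>.\<close>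

definition graded_component ::
    "('n::finite, 'k::field) mpoly_ring set \<Rightarrow> nat \<Rightarrow> ('n, 'k) mpoly_ring set set" where
  "graded_component J d = residue_class J ` homogeneous_part d"

text \<open>
  The number \<open>e\<close> with \<open>A = A\<^sub>0 \<oplus> \<dots> \<oplus> A\<^sub>e\<close> and \<open>A\<^sub>e \<noteq> 0\<close>. It is meaningful only if \<open>A\<close> is
  nonzero and Artinian, so that some but only finitely many components are nonzero.
\<close>

definition top_degree :: "('n::finite, 'k::field) mpoly_ring set \<Rightarrow> nat" where
  "top_degree J = (GREATEST e. graded_component J e \<noteq> {\<zero>\<^bsub>quotient_algebra J\<^esub>})"

text \<open>
  The weak Lefschetz property of \<open>R/J\<close>, for a homogeneous ideal \<open>J\<close> with \<open>R/J\<close> nonzero and Artinian.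
\<close>

definition weak_Lefschetz :: "('n::finite, 'k::field) mpoly_ring set \<Rightarrow> bool" where
  "weak_Lefschetz J \<longleftrightarrow>
     (\<exists>l \<in> homogeneous_part 1. \<forall>i < top_degree J.
        let mult_l = (\<lambda>a. residue_class J l \<otimes>\<^bsub>quotient_algebra J\<^esub> a)
        in inj_on mult_l (graded_component J i) \<or>
           mult_l ` graded_component J i = graded_component J (i + 1))"

text \<open>
  The second family of generators ranges over ordered pairs \<open>i \<noteq> j\<close>, and so contains both
  \<open>x\<^sub>i\<^bsup>\<alpha>-2\<^esup>x\<^sub>j\<^bsup>2\<^esup>\<close> and \<open>x\<^sub>i\<^bsup>2\<^esup>x\<^sub>j\<^bsup>\<alpha>-2\<^esup>\<close> for each unordered pair of variables.
\<close>

definition J_ideal :: "nat \<Rightarrow> ('n, 'k::field) mpoly_ring set" where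
  "J_ideal \<alpha> = Idl\<^bsub>poly_ring\<^esub>
     ({var i ^ \<alpha> | i. True} \<union> {var i ^ (\<alpha> - 2) * var j ^ 2 | i j. i \<noteq> j})"

end

theory Submission
  imports Defs
begin

text \<open>
  For every linear form \<open>l\<close>, multiplication by \<open>l\<close> from degree \<open>\<alpha> - 1\<close> to degree \<open>\<alpha>\<close> is neither
  injective nor surjective on \<open>A = R/J\<close>.

  Injectivity fails because of the characteristic: \<open>l = \<Sum> c\<^sub>j x\<^sub>j\<close> has \<open>l\<^sup>2 = \<Sum> c\<^sub>j\<^sup>2 x\<^sub>j\<^sup>2\<close>, so
  \<open>x\<^sub>i\<^bsup>\<alpha>-2\<^esup> l\<^sup>2 \<in> J\<close>, since every \<open>x\<^sub>i\<^bsup>\<alpha>-2\<^esup> x\<^sub>j\<^sup>2\<close> lies in \<open>J\<close>. All generators of \<open>J\<close> have degree \<open>\<alpha>\<close>,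
  so \<open>x\<^sub>i\<^bsup>\<alpha>-2\<^esup> l\<close>, of degree \<open>\<alpha> - 1\<close>, is a nonzero element of the kernel if \<open>l \<noteq> 0\<close>
  (lemma \<open>not_inj_mult_linear_form\<close>).

  Surjectivity fails in any characteristic. It suffices to find a nonzero functional on \<open>R\<^sub>\<alpha>\<close> that
  vanishes on \<open>J\<close> and on the multiples of \<open>l\<close>. Let \<open>R\<close> act by contraction on the divided power
  algebra in dual variables \<open>X\<^sub>i\<close>. Choose four variables
  \<open>p, q, a, b\<close> and nonzero pairs \<open>(s, t)\<close>, \<open>(u, v)\<close> with \<open>c\<^sub>p s + c\<^sub>q t = 0\<close> and \<open>c\<^sub>a u + c\<^sub>b v = 0\<close>. Then
  \<open>(s X\<^sub>p + t X\<^sub>q) (u X\<^sub>a + v X\<^sub>b)\<^bsup>[\<alpha>-1]\<^esup>\<close> is such a functional: \<open>l\<close> acts on the divided power algebra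
  as a derivation, which kills both linear forms; and each monomial in its support has exponent
  exactly \<open>1\<close> at one of \<open>p\<close>, \<open>q\<close>, so none of them is a generator of \<open>J\<close>
  (lemmas \<open>binary_weight_linear_form\<close>, \<open>binary_weight_generators\<close> and
  \<open>not_surj_mult_linear_form\<close>). The functional also shows \<open>A\<^sub>\<alpha> \<noteq> 0\<close>, so that the degree \<open>\<alpha> - 1\<close> lies
  below the top degree of \<open>A\<close>.
\<close>

section \<open>Functionals given by weights on monomials\<close>

text \<open>
  The linear functional on polynomials with value \<open>w m\<close> at the monomial with exponent vector \<open>m\<close>.
\<close>

definition weighted_sum ::
    "(('n \<Rightarrow>\<^sub>0 nat) \<Rightarrow> 'k::field) \<Rightarrow> ('n, 'k) mpoly_ring \<Rightarrow> 'k" where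
  "weighted_sum w f = (\<Sum>m\<in>Poly_Mapping.keys f. Poly_Mapping.lookup f m * w m)"

lemma weighted_sum_superset:
  assumes "finite S" "Poly_Mapping.keys f \<subseteq> S"
  shows "weighted_sum w f = (\<Sum>m\<in>S. Poly_Mapping.lookup f m * w m)"
  unfolding weighted_sum_def
  by (rule sum.mono_neutral_left) (use assms in \<open>auto simp: in_keys_iff\<close>)

lemma weighted_sum_0 [simp]: "weighted_sum w 0 = 0"
  by (simp add: weighted_sum_def)

lemma weighted_sum_single [simp]: "weighted_sum w (Poly_Mapping.single m c) = c * w m"
  by (simp add: weighted_sum_def)

lemma weighted_sum_add: "weighted_sum w (f + g) = weighted_sum w f + weighted_sum w g"
proof -
  let ?S = "Poly_Mapping.keys f \<union> Poly_Mapping.keys g"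
  have "weighted_sum w h = (\<Sum>m\<in>?S. Poly_Mapping.lookup h m * w m)" if "h \<in> {f, g, f + g}" for h
    by (rule weighted_sum_superset) (use that keys_add[of f g] in auto)
  then show ?thesis
    by (simp add: lookup_add algebra_simps sum.distrib)
qed

lemma weighted_sum_sum: "weighted_sum w (\<Sum>i\<in>I. f i) = (\<Sum>i\<in>I. weighted_sum w (f i))"
  by (induction I rule: infinite_finite_induct) (simp_all add: weighted_sum_add)

lemma sum_of_monomials:
  "f = (\<Sum>m\<in>Poly_Mapping.keys f. Poly_Mapping.single m (Poly_Mapping.lookup f m))"
  by (rule poly_mapping_eqI) (auto simp: lookup_sum lookup_single when_def in_keys_iff)

lemma weighted_sum_mult_eq_0:
  assumes "\<And>n c. weighted_sum w (f * Poly_Mapping.single n c) = 0"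
  shows "weighted_sum w (f * g) = 0"
proof -
  have "weighted_sum w (f * g) = weighted_sum w
      (\<Sum>n\<in>Poly_Mapping.keys g. f * Poly_Mapping.single n (Poly_Mapping.lookup g n))"
    by (subst sum_of_monomials[of g]) (simp add: sum_distrib_left)
  then show ?thesis
    by (simp add: weighted_sum_sum assms)
qed

section \<open>Ideals and residue classes of polynomials\<close>

lemma poly_ring_simps [simp]:
  "carrier (poly_ring :: ('n, 'k::field) mpoly_ring ring) = UNIV"
  "f \<otimes>\<^bsub>poly_ring\<^esub> g = (f * g :: ('n, 'k) mpoly_ring)"
  "f \<oplus>\<^bsub>poly_ring\<^esub> g = (f + g :: ('n, 'k) mpoly_ring)"
  "\<zero>\<^bsub>poly_ring\<^esub> = (0 :: ('n, 'k) mpoly_ring)"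
  "\<one>\<^bsub>poly_ring\<^esub> = (1 :: ('n, 'k) mpoly_ring)"
  by (simp_all add: ring_of_type_algebra_def)

lemma ring_poly_ring: "ring (poly_ring :: ('n, 'k::field) mpoly_ring ring)"
  by (rule ring_from_type_algebra)

text \<open>
  The locale restates the closure properties of an ideal, and the arithmetic of its residue classes,
  in terms of the type-class operations on polynomials.
\<close>

locale poly_ideal =
  fixes J :: "('n, 'k::field) mpoly_ring set"
  assumes ideal: "ideal J poly_ring"
begin

lemma zero_mem: "0 \<in> J"
  using additive_subgroup.zero_closed[OF ideal.axioms(1)[OF ideal]] by simp

lemma add_mem: "f \<in> J \<Longrightarrow> g \<in> J \<Longrightarrow> f + g \<in> J"
  using additive_subgroup.a_closed[OF ideal.axioms(1)[OF ideal]] by simp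

lemma mult_mem: "f \<in> J \<Longrightarrow> g * f \<in> J"
  using ideal.I_l_closed[OF ideal] by simp

lemma sum_mem: "(\<And>i. i \<in> I \<Longrightarrow> f i \<in> J) \<Longrightarrow> (\<Sum>i\<in>I. f i) \<in> J"
  by (induction I rule: infinite_finite_induct) (auto intro: zero_mem add_mem)

lemma diff_mem: "f \<in> J \<Longrightarrow> g \<in> J \<Longrightarrow> f - g \<in> J"
  using add_mem[of f "- 1 * g"] mult_mem[of g "- 1"] by simp

lemma residue_class_eq: "residue_class J f = (\<lambda>h. h + f) ` J"
  by (auto simp: residue_class_def a_r_coset_def')

lemma residue_class_eq_iff: "residue_class J f = residue_class J g \<longleftrightarrow> f - g \<in> J"
proof
  assume "residue_class J f = residue_class J g"
  moreover have "f \<in> residue_class J f"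
    using zero_mem by (force simp: residue_class_eq)
  ultimately show "f - g \<in> J"
    by (auto simp: residue_class_eq)
next
  assume *: "f - g \<in> J"
  show "residue_class J f = residue_class J g"
    unfolding residue_class_eq
  proof (intro equalityI subsetI; elim imageE)
    fix h k assume "h = k + f" "k \<in> J"
    then show "h \<in> (\<lambda>h. h + g) ` J"
      using add_mem[OF _ *, of k] by (intro image_eqI[of _ _ "k + (f - g)"]) auto
  next
    fix h k assume "h = k + g" "k \<in> J"
    then show "h \<in> (\<lambda>h. h + f) ` J"
      using diff_mem[OF _ *, of k] by (intro image_eqI[of _ _ "k - (f - g)"]) auto
  qed
qed

lemma residue_class_0: "residue_class J 0 = \<zero>\<^bsub>quotient_algebra J\<^esub>"
  by (simp add: residue_class_eq FactRing_def)

lemma residue_class_mult: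
  "residue_class J f \<otimes>\<^bsub>quotient_algebra J\<^esub> residue_class J g = residue_class J (f * g)"
  using ideal.rcoset_mult_add[OF ideal, of f g] by (simp add: residue_class_def FactRing_def)

end

text \<open>
  The largest ideal contained in the kernel of a functional. An ideal lies in the kernel as soon as
  its generators belong to this ideal.
\<close>

lemma ideal_weighted_sum:
  "ideal {f. \<forall>h. weighted_sum w (f * h) = 0} (poly_ring :: ('n, 'k::field) mpoly_ring ring)"
  (is "ideal ?K _")
proof (rule idealI)
  interpret R: ring "poly_ring :: ('n, 'k) mpoly_ring ring"
    by (rule ring_poly_ring)
  have mult: "f * g \<in> ?K" if "f \<in> ?K" for f g
    using that by (simp add: mult.assoc)
  show "subgroup ?K (add_monoid poly_ring)"
  proof (rule R.add.subgroupI)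
    fix f assume f: "f \<in> ?K"
    have "\<ominus>\<^bsub>poly_ring\<^esub> f = f * (- 1)"
      by (rule R.minus_equality) simp_all
    then show "\<ominus>\<^bsub>poly_ring\<^esub> f \<in> ?K"
      using mult[OF f, of "- 1"] by simp
  qed (auto simp: distrib_right weighted_sum_add intro: exI[of _ 0])
qed (auto simp: ring_poly_ring mult.assoc mult.left_commute)

section \<open>The ideal and its low and high degrees\<close>

text \<open>The degree \<open>\<Sum> m\<^sub>i\<close> of the monomial with exponent vector \<open>m\<close>.\<close>

definition total_degree :: "('n::finite \<Rightarrow>\<^sub>0 nat) \<Rightarrow> nat" where
  "total_degree m = (\<Sum>i\<in>UNIV. Poly_Mapping.lookup m i)"

lemma total_degree_add: "total_degree (m + n) = total_degree m + total_degree n"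
  by (simp add: total_degree_def lookup_add sum.distrib)

lemma total_degree_single [simp]: "total_degree (Poly_Mapping.single i k) = k"
  by (simp add: total_degree_def lookup_single when_def)

lemma mem_homogeneous_part:
  "f \<in> homogeneous_part d \<longleftrightarrow> (\<forall>m\<in>Poly_Mapping.keys f. total_degree m = d)"
  by (simp add: homogeneous_part_def total_degree_def)

lemma single_mem_homogeneous_part:
  "total_degree m = d \<Longrightarrow> Poly_Mapping.single m c \<in> homogeneous_part d"
  by (auto simp: mem_homogeneous_part split: if_splits)

lemma mult_mem_homogeneous_part:
  "f \<in> homogeneous_part d \<Longrightarrow> g \<in> homogeneous_part e \<Longrightarrow> f * g \<in> homogeneous_part (d + e)"
  using keys_mult[of f g] by (force simp: mem_homogeneous_part total_degree_add)

lemma var_power: "var i ^ k = Poly_Mapping.single (Poly_Mapping.single i k) 1"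
  by (induction k) (simp_all add: var_def mult_single flip: single_add)

lemma poly_ideal_J_ideal: "poly_ideal (J_ideal \<alpha> :: ('n, 'k::field) mpoly_ring set)"
  unfolding J_ideal_def
  by (intro poly_ideal.intro ring.genideal_ideal[OF ring_poly_ring]) simp

lemma generators_mem_J_ideal:
  "var i ^ \<alpha> \<in> J_ideal \<alpha>"
  "i \<noteq> j \<Longrightarrow> var i ^ (\<alpha> - 2) * var j ^ 2 \<in> J_ideal \<alpha>"
  unfolding J_ideal_def by (rule subsetD[OF ring.genideal_self[OF ring_poly_ring]]; auto)+

text \<open>
  A functional whose weight is zero at all monomial multiples of the generators vanishes on the
  ideal.
\<close>

lemma weighted_sum_J_ideal:
  fixes w :: "('n \<Rightarrow>\<^sub>0 nat) \<Rightarrow> 'k::field"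
  assumes "\<And>i n. w (Poly_Mapping.single i \<alpha> + n) = 0"
    and "\<And>i j n. i \<noteq> j \<Longrightarrow>
      w (Poly_Mapping.single i (\<alpha> - 2) + Poly_Mapping.single j 2 + n) = 0"
    and "f \<in> J_ideal \<alpha>"
  shows "weighted_sum w f = 0"
proof -
  have "J_ideal \<alpha> \<subseteq> {f. \<forall>h. weighted_sum w (f * h) = 0}"
    unfolding J_ideal_def
  proof (intro ring.genideal_minimal[OF ring_poly_ring ideal_weighted_sum] subsetI)
    fix g :: "('n, 'k) mpoly_ring"
    assume "g \<in> {var i ^ \<alpha> |i. True} \<union> {var i ^ (\<alpha> - 2) * (var j)\<^sup>2 |i j. i \<noteq> j}"
    then have "weighted_sum w (g * Poly_Mapping.single n c) = 0" for n c
      using assms(1,2) by (auto simp: var_power mult_single)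
    then show "g \<in> {f. \<forall>h. weighted_sum w (f * h) = 0}"
      using weighted_sum_mult_eq_0 by blast
  qed
  then have "weighted_sum w (f * 1) = 0"
    using assms(3) by blast
  then show ?thesis
    by simp
qed

lemma lookup_J_ideal_eq_0:
  fixes f :: "('n::finite, 'k::field) mpoly_ring"
  assumes "f \<in> J_ideal \<alpha>" and "total_degree m < \<alpha>"
  shows "Poly_Mapping.lookup f m = 0"
proof -
  \<comment> \<open>Extracting a coefficient is the functional whose weight is the indicator of \<open>m\<close>.\<close>
  have "weighted_sum (\<lambda>n. if n = m then 1 else 0) f = 0"
    using assms(2) by (intro weighted_sum_J_ideal[OF _ _ assms(1)]) (auto simp: total_degree_add)
  then show ?thesis
    by (auto simp: weighted_sum_def if_distrib in_keys_iff cong: if_cong split: if_splits)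
qed

lemma homogeneous_J_ideal_eq_0:
  fixes f :: "('n::finite, 'k::field) mpoly_ring"
  assumes "f \<in> J_ideal \<alpha>" "f \<in> homogeneous_part d" "d < \<alpha>"
  shows "f = 0"
  using assms lookup_J_ideal_eq_0[OF assms(1)]
  by (intro poly_mapping_eqI) (metis in_keys_iff lookup_zero mem_homogeneous_part)

text \<open>
  In large degree every monomial has an exponent at least \<open>\<alpha>\<close>. This bounds the degrees of the nonzero
  components of the quotient, so that \<^const>\<open>top_degree\<close> is their maximum once there is one.
\<close>

lemma homogeneous_part_subset_J_ideal:
  assumes "card (UNIV :: 'n set) * \<alpha> < d"
  shows "homogeneous_part d \<subseteq> (J_ideal \<alpha> :: ('n::finite, 'k::field) mpoly_ring set)"
proof
  interpret poly_ideal "J_ideal \<alpha> :: ('n, 'k) mpoly_ring set"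
    by (rule poly_ideal_J_ideal)
  fix f :: "('n, 'k) mpoly_ring"
  assume f: "f \<in> homogeneous_part d"
  have "Poly_Mapping.single m c \<in> (J_ideal \<alpha> :: ('n, 'k) mpoly_ring set)"
    if "m \<in> Poly_Mapping.keys f" for m c
  proof -
    have "\<exists>i. \<alpha> \<le> Poly_Mapping.lookup m i"
    proof (rule ccontr)
      assume "\<not> ?thesis"
      then have "total_degree m \<le> (\<Sum>i\<in>(UNIV::'n set). \<alpha>)"
        unfolding total_degree_def by (intro sum_mono) (simp add: not_le less_imp_le)
      then show False
        using that f assms by (simp add: mem_homogeneous_part)
    qed
    then obtain i where i: "\<alpha> \<le> Poly_Mapping.lookup m i" ..
    have "m - Poly_Mapping.single i \<alpha> + Poly_Mapping.single i \<alpha> = m"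
      using i by (intro poly_mapping_eqI) (auto simp: lookup_add lookup_minus lookup_single when_def)
    then have "Poly_Mapping.single m c =
        Poly_Mapping.single (m - Poly_Mapping.single i \<alpha>) c * var i ^ \<alpha>"
      by (simp add: var_power mult_single)
    then show ?thesis
      by (simp add: mult_mem generators_mem_J_ideal)
  qed
  then show "f \<in> J_ideal \<alpha>"
    by (subst sum_of_monomials) (rule sum_mem)
qed

lemma le_top_degree_J_ideal:
  fixes f :: "('n::finite, 'k::field) mpoly_ring"
  assumes "f \<in> homogeneous_part d" "f \<notin> J_ideal \<alpha>"
  shows "d \<le> top_degree (J_ideal \<alpha> :: ('n, 'k) mpoly_ring set)"
proof -
  let ?J = "J_ideal \<alpha> :: ('n, 'k) mpoly_ring set"
  interpret poly_ideal ?J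
    by (rule poly_ideal_J_ideal)
  have zero_iff: "residue_class ?J g = \<zero>\<^bsub>quotient_algebra ?J\<^esub> \<longleftrightarrow> g \<in> ?J" for g
    using residue_class_eq_iff[of g 0] by (simp add: residue_class_0)
  have "residue_class ?J f \<in> graded_component ?J d"
    using assms(1) by (simp add: graded_component_def)
  then have "graded_component ?J d \<noteq> {\<zero>\<^bsub>quotient_algebra ?J\<^esub>}"
    using assms(2) zero_iff[of f] by auto
  moreover have "e \<le> card (UNIV :: 'n set) * \<alpha>"
    if "graded_component ?J e \<noteq> {\<zero>\<^bsub>quotient_algebra ?J\<^esub>}" for e
  proof (rule ccontr)
    assume "\<not> ?thesis"
    then have "homogeneous_part e \<subseteq> ?J"
      by (intro homogeneous_part_subset_J_ideal) simp
    then have "residue_class ?J g = \<zero>\<^bsub>quotient_algebra ?J\<^esub>" if "g \<in> homogeneous_part e" for g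
      using that by (simp only: zero_iff subsetD)
    then have "graded_component ?J e =
        (\<lambda>_. \<zero>\<^bsub>quotient_algebra ?J\<^esub>) ` (homogeneous_part e :: ('n, 'k) mpoly_ring set)"
      unfolding graded_component_def by - (rule image_cong, simp_all)
    moreover have "(0 :: ('n, 'k) mpoly_ring) \<in> homogeneous_part e"
      by (simp add: mem_homogeneous_part)
    ultimately have "graded_component ?J e = {\<zero>\<^bsub>quotient_algebra ?J\<^esub>}"
      by (simp add: image_constant)
    with that show False ..
  qed
  ultimately show ?thesis
    unfolding top_degree_def by (rule Greatest_le_nat)
qed

section \<open>Failure of injectivity\<close>

lemma linear_form_expansion:
  fixes l :: "('n::finite, 'k::field) mpoly_ring"
  assumes "l \<in> homogeneous_part 1"
  obtains c where "l = (\<Sum>i\<in>UNIV. Poly_Mapping.single (Poly_Mapping.single i 1) (c i))"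
proof
  let ?e = "\<lambda>i::'n. Poly_Mapping.single i (1::nat)"
  have inj: "inj ?e"
    by (rule injI) (metis keys_single one_neq_zero singleton_inject)
  have "Poly_Mapping.keys l \<subseteq> range ?e"
  proof
    fix m assume "m \<in> Poly_Mapping.keys l"
    then have "(\<Sum>i\<in>UNIV. Poly_Mapping.lookup m i) = 1"
      using assms by (simp add: mem_homogeneous_part total_degree_def)
    then obtain i where "Poly_Mapping.lookup m i = 1" "\<forall>j. j \<noteq> i \<longrightarrow> Poly_Mapping.lookup m j = 0"
      by (auto simp: sum_eq_Suc0_iff)
    then have "m = ?e i"
      by (intro poly_mapping_eqI) (auto simp: lookup_single when_def)
    then show "m \<in> range ?e" by simp
  qed
  then have "l = (\<Sum>m\<in>range ?e. Poly_Mapping.single m (Poly_Mapping.lookup l m))"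
    by (subst sum_of_monomials, intro sum.mono_neutral_left) (auto simp: in_keys_iff)
  also have "\<dots> = (\<Sum>i\<in>UNIV. Poly_Mapping.single (?e i) (Poly_Mapping.lookup l (?e i)))"
    using sum.reindex[OF inj] by simp
  finally show "l = (\<Sum>i\<in>UNIV. Poly_Mapping.single (?e i) (Poly_Mapping.lookup l (?e i)))" .
qed

lemma square_sum_CHAR_2:
  fixes f :: "'i \<Rightarrow> 'a::comm_ring_1"
  assumes "(2 :: 'a) = 0"
  shows "(\<Sum>i\<in>I. f i)\<^sup>2 = (\<Sum>i\<in>I. (f i)\<^sup>2)"
proof (induction I rule: infinite_finite_induct)
  case (insert i I)
  have "(f i + sum f I)\<^sup>2 = (f i)\<^sup>2 + (sum f I)\<^sup>2"
    by (simp add: power2_sum assms)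
  with insert show ?case by simp
qed simp_all

lemma var_power_times_square_mem_J_ideal:
  fixes l :: "('n::finite, 'k::field) mpoly_ring"
  assumes "CHAR('k) = 2" "\<alpha> \<ge> 2" "l \<in> homogeneous_part 1"
  shows "var i ^ (\<alpha> - 2) * l\<^sup>2 \<in> J_ideal \<alpha>"
proof -
  interpret poly_ideal "J_ideal \<alpha> :: ('n, 'k) mpoly_ring set"
    by (rule poly_ideal_J_ideal)
  obtain c where l: "l = (\<Sum>j\<in>UNIV. Poly_Mapping.single (Poly_Mapping.single j 1) (c j))"
    using linear_form_expansion[OF assms(3)] .
  have "(2 :: 'k) = 0"
    using of_nat_CHAR[where 'a = 'k] assms(1) by simp
  then have two: "(2 :: ('n, 'k) mpoly_ring) = 0"
    by (metis single_numeral single_zero)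
  have square: "(Poly_Mapping.single (Poly_Mapping.single j 1) (c j))\<^sup>2 =
      Poly_Mapping.single 0 ((c j)\<^sup>2) * (var j)\<^sup>2" for j
    by (subst var_power) (simp add: power2_eq_square mult_single numeral_2_eq_2 flip: single_add)
  have "var i ^ (\<alpha> - 2) * (var j)\<^sup>2 \<in> (J_ideal \<alpha> :: ('n, 'k) mpoly_ring set)" for j
  proof (cases "i = j")
    case True
    then have "var i ^ (\<alpha> - 2) * (var j)\<^sup>2 = (var i ^ \<alpha> :: ('n, 'k) mpoly_ring)"
      using assms(2) by (metis power_add le_add_diff_inverse2)
    then show ?thesis
      using generators_mem_J_ideal(1)[of i \<alpha>] by simp
  qed (rule generators_mem_J_ideal(2))
  then have "(\<Sum>j\<in>UNIV. Poly_Mapping.single 0 ((c j)\<^sup>2) * (var i ^ (\<alpha> - 2) * (var j)\<^sup>2))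
      \<in> (J_ideal \<alpha> :: ('n, 'k) mpoly_ring set)"
    by (intro sum_mem) (rule mult_mem)
  then show ?thesis
    by (simp add: l square_sum_CHAR_2[OF two] square[simplified] sum_distrib_left mult.left_commute)
qed

lemma not_inj_mult_linear_form:
  fixes l :: "('n::finite, 'k::field) mpoly_ring"
  assumes "CHAR('k) = 2" "\<alpha> \<ge> 2" "l \<in> homogeneous_part 1"
  obtains f where "f \<in> homogeneous_part (\<alpha> - 1)" "f \<notin> J_ideal \<alpha>" "l * f \<in> J_ideal \<alpha>"
proof -
  interpret poly_ideal "J_ideal \<alpha> :: ('n, 'k) mpoly_ring set"
    by (rule poly_ideal_J_ideal)
  fix i :: 'n
  \<comment> \<open>The kernel element is \<open>x\<^sub>i\<^bsup>\<alpha>-2\<^esup> l\<close>, with \<open>l\<close> replaced by \<open>x\<^sub>i\<close> if \<open>l = 0\<close>.\<close>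
  have var: "var i \<in> (homogeneous_part 1 :: ('n, 'k) mpoly_ring set)"
    by (simp add: var_def single_mem_homogeneous_part)
  have "Poly_Mapping.lookup (var i :: ('n, 'k) mpoly_ring) (Poly_Mapping.single i 1) \<noteq> 0"
    by (simp add: var_def)
  then have "var i \<noteq> (0 :: ('n, 'k) mpoly_ring)"
    by force
  then obtain g :: "('n, 'k) mpoly_ring"
    where g: "g \<in> homogeneous_part 1" "g \<noteq> 0" "l = 0 \<or> g = l"
    using var assms(3) by (cases "l = 0") auto
  define f where "f = var i ^ (\<alpha> - 2) * g"
  obtain m where m: "Poly_Mapping.lookup g m \<noteq> 0"
    using g(2) by (metis lookup_zero poly_mapping_eqI)
  have "f = (\<Sum>n\<in>Poly_Mapping.keys g. Poly_Mapping.single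
      (Poly_Mapping.single i (\<alpha> - 2) + n) (Poly_Mapping.lookup g n))"
    unfolding f_def
    by (subst sum_of_monomials[of g]) (simp add: sum_distrib_left var_power mult_single)
  then have "Poly_Mapping.lookup f (Poly_Mapping.single i (\<alpha> - 2) + m) = Poly_Mapping.lookup g m"
    by (simp add: lookup_sum lookup_single when_def in_keys_iff)
  then have "f \<noteq> 0"
    using m by auto
  moreover have f: "f \<in> homogeneous_part (\<alpha> - 1)"
  proof -
    have "var i ^ (\<alpha> - 2) \<in> (homogeneous_part (\<alpha> - 2) :: ('n, 'k) mpoly_ring set)"
      by (simp add: var_power single_mem_homogeneous_part)
    then have "f \<in> homogeneous_part (\<alpha> - 2 + 1)"
      unfolding f_def using g(1) by (rule mult_mem_homogeneous_part)
    moreover have "\<alpha> - 2 + 1 = \<alpha> - 1"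
      using assms(2) by linarith
    ultimately show ?thesis by simp
  qed
  ultimately have "f \<notin> J_ideal \<alpha>"
    using homogeneous_J_ideal_eq_0[of f \<alpha> "\<alpha> - 1"] assms(2) by auto
  moreover have "l * f \<in> J_ideal \<alpha>"
  proof (cases "l = 0")
    case True
    then show ?thesis
      by (simp add: zero_mem)
  next
    case False
    then have "l * f = var i ^ (\<alpha> - 2) * l\<^sup>2"
      using g(3) by (simp add: f_def power2_eq_square mult.left_commute)
    then show ?thesis
      using var_power_times_square_mem_J_ideal[OF assms, of i] by simp
  qed
  ultimately show ?thesis
    using that f by blast
qed

section \<open>Failure of surjectivity\<close>

text \<open>
  The coefficients of \<open>(s X\<^sub>p + t X\<^sub>q) (u X\<^sub>a + v X\<^sub>b)\<^bsup>[\<alpha>-1]\<^esup>\<close> in the divided power algebra, where the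
  divided power of a binary form is
  \<open>(u X\<^sub>a + v X\<^sub>b)\<^bsup>[d]\<^esup> = \<Sum>\<^bsub>i+j=d\<^esub> u\<^sup>i v\<^sup>j X\<^sub>a\<^bsup>[i]\<^esup> X\<^sub>b\<^bsup>[j]\<^esup>\<close>. The four indices are meant to be distinct.
\<close>

definition binary_weight ::
    "nat \<Rightarrow> 'n \<Rightarrow> 'n \<Rightarrow> 'n \<Rightarrow> 'n \<Rightarrow> 'k \<Rightarrow> 'k \<Rightarrow> 'k \<Rightarrow> 'k \<Rightarrow> ('n \<Rightarrow>\<^sub>0 nat) \<Rightarrow> 'k::field" where
  "binary_weight \<alpha> p q a b s t u v m =
     (if Poly_Mapping.lookup m p + Poly_Mapping.lookup m q = 1 \<and>
         Poly_Mapping.lookup m a + Poly_Mapping.lookup m b = \<alpha> - 1 \<and>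
         (\<forall>i. i \<notin> {p, q, a, b} \<longrightarrow> Poly_Mapping.lookup m i = 0)
      then s ^ Poly_Mapping.lookup m p * t ^ Poly_Mapping.lookup m q *
           u ^ Poly_Mapping.lookup m a * v ^ Poly_Mapping.lookup m b
      else 0)"

lemma binary_weight_nonzeroD:
  assumes "binary_weight \<alpha> p q a b s t u v m \<noteq> 0"
  shows "Poly_Mapping.lookup m p + Poly_Mapping.lookup m q = 1"
    and "Poly_Mapping.lookup m a + Poly_Mapping.lookup m b = \<alpha> - 1"
    and "i \<notin> {p, q, a, b} \<Longrightarrow> Poly_Mapping.lookup m i = 0"
  using assms unfolding binary_weight_def by (metis (no_types, lifting))+

text \<open>
  A monomial of nonzero weight has exponent at most \<open>1\<close> outside \<open>a\<close>, \<open>b\<close>, and its exponents at \<open>a\<close>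
  and \<open>b\<close> add up to \<open>\<alpha> - 1\<close> only.
\<close>

lemma binary_weight_generators:
  assumes "\<alpha> \<ge> 4" "distinct [p, q, a, b]"
  shows "binary_weight \<alpha> p q a b s t u v (Poly_Mapping.single i \<alpha> + n) = 0"
    and "i \<noteq> j \<Longrightarrow> binary_weight \<alpha> p q a b s t u v
      (Poly_Mapping.single i (\<alpha> - 2) + Poly_Mapping.single j 2 + n) = 0"
proof -
  have mem: "i \<in> {a, b}"
    if "binary_weight \<alpha> p q a b s t u v m \<noteq> 0" "Poly_Mapping.lookup m i \<ge> 2" for m i
  proof -
    note D = binary_weight_nonzeroD[OF that(1)]
    have "i \<noteq> p" "i \<noteq> q"
      using D(1) that(2) by auto
    then show ?thesis
      using D(3)[of i] that(2) by auto
  qed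
  have total: "Poly_Mapping.lookup m i + Poly_Mapping.lookup m j < \<alpha>"
    if "binary_weight \<alpha> p q a b s t u v m \<noteq> 0" "i \<in> {a, b}" "j \<in> {a, b}" "i \<noteq> j" for m i j
    using binary_weight_nonzeroD(2)[OF that(1)] that(2-4) assms(1) by auto
  let ?m = "Poly_Mapping.single i \<alpha> + n"
  have "Poly_Mapping.lookup ?m i \<ge> \<alpha>"
    by (simp add: lookup_add)
  then show "binary_weight \<alpha> p q a b s t u v ?m = 0"
    using assms mem[of ?m i] total[of ?m a b] by fastforce
  assume ij: "i \<noteq> j"
  let ?m = "Poly_Mapping.single i (\<alpha> - 2) + Poly_Mapping.single j 2 + n"
  have "Poly_Mapping.lookup ?m i \<ge> \<alpha> - 2" "Poly_Mapping.lookup ?m j \<ge> 2"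
    using ij by (simp_all add: lookup_add)
  then show "binary_weight \<alpha> p q a b s t u v ?m = 0"
    using assms(1) mem[of ?m i] mem[of ?m j] total[of ?m i j] ij by linarith
qed

text \<open>
  The contraction of the functional by the linear form \<open>\<Sum> c\<^sub>i x\<^sub>i\<close> is zero.
\<close>

lemma binary_weight_linear_form:
  fixes c :: "'n::finite \<Rightarrow> 'k::field"
  assumes distinct: "distinct [p, q, a, b]"
    and st: "c p * s + c q * t = 0" and uv: "c a * u + c b * v = 0"
  shows "(\<Sum>i\<in>UNIV. c i * binary_weight \<alpha> p q a b s t u v (Poly_Mapping.single i 1 + n)) = 0"
proof -
  let ?L = "Poly_Mapping.lookup n"
  define W where "W i = binary_weight \<alpha> p q a b s t u v (Poly_Mapping.single i 1 + n)" for i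
  define M where "M = s ^ ?L p * t ^ ?L q * u ^ ?L a * v ^ ?L b"
  have L: "Poly_Mapping.lookup (Poly_Mapping.single i 1 + n) j = (if j = i then Suc (?L j) else ?L j)"
    for i j by (simp add: lookup_add lookup_single when_def)
  have W_other: "W i = 0" if "i \<notin> {p, q, a, b}" for i
    unfolding W_def binary_weight_def L using that by auto
  define supp where "supp \<longleftrightarrow> (\<forall>i. i \<notin> {p, q, a, b} \<longrightarrow> ?L i = 0)"
  have supp: "(\<forall>j. j \<notin> {p, q, a, b} \<longrightarrow>
      Poly_Mapping.lookup (Poly_Mapping.single i 1 + n) j = 0) \<longleftrightarrow> supp" if "i \<in> {p, q, a, b}" for i
    unfolding supp_def L using that by auto
  \<comment> \<open>Multiplying the monomial \<open>n\<close> by \<open>x\<^sub>p\<close> or \<open>x\<^sub>q\<close> leads into the support in case \<open>P\<close>, and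
    multiplying it by \<open>x\<^sub>a\<close> or \<open>x\<^sub>b\<close> does in case \<open>Q\<close>.\<close>
  define P where "P \<longleftrightarrow> ?L p + ?L q = 0 \<and> ?L a + ?L b = \<alpha> - 1 \<and> supp"
  define Q where "Q \<longleftrightarrow> ?L p + ?L q = 1 \<and> Suc (?L a + ?L b) = \<alpha> - 1 \<and> supp"
  have W_eq: "W i = (if Poly_Mapping.lookup (Poly_Mapping.single i 1 + n) p +
        Poly_Mapping.lookup (Poly_Mapping.single i 1 + n) q = 1 \<and>
      Poly_Mapping.lookup (Poly_Mapping.single i 1 + n) a +
        Poly_Mapping.lookup (Poly_Mapping.single i 1 + n) b = \<alpha> - 1 \<and> supp
    then s ^ Poly_Mapping.lookup (Poly_Mapping.single i 1 + n) p *
      t ^ Poly_Mapping.lookup (Poly_Mapping.single i 1 + n) q *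
      u ^ Poly_Mapping.lookup (Poly_Mapping.single i 1 + n) a *
      v ^ Poly_Mapping.lookup (Poly_Mapping.single i 1 + n) b else 0)"
    if "i \<in> {p, q, a, b}" for i
    unfolding W_def binary_weight_def supp[OF that] ..
  have ne: "p \<noteq> q" "p \<noteq> a" "p \<noteq> b" "q \<noteq> a" "q \<noteq> b" "a \<noteq> b"
    "q \<noteq> p" "a \<noteq> p" "b \<noteq> p" "a \<noteq> q" "b \<noteq> q" "b \<noteq> a"
    using distinct by auto
  have W: "W p = (if P then s * M else 0)" "W q = (if P then t * M else 0)"
    "W a = (if Q then u * M else 0)" "W b = (if Q then v * M else 0)"
    by (simp_all add: W_eq L ne P_def Q_def M_def del: One_nat_def)
  have "(\<Sum>i\<in>UNIV. c i * W i) = (\<Sum>i\<in>{p, q, a, b}. c i * W i)"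
    using W_other by (intro sum.mono_neutral_right) auto
  also have "\<dots> = (c p * W p + c q * W q) + (c a * W a + c b * W b)"
    using distinct by (simp add: add.assoc)
  also have "c p * W p + c q * W q = (if P then (c p * s + c q * t) * M else 0)"
    by (simp add: W algebra_simps)
  also have "c a * W a + c b * W b = (if Q then (c a * u + c b * v) * M else 0)"
    by (simp add: W algebra_simps)
  finally show ?thesis
    by (simp add: W_def st uv)
qed

lemma nontrivial_zero_of_binary_form:
  fixes x y :: "'k::field"
  obtains s t where "x * s + y * t = 0" "s \<noteq> 0 \<or> t \<noteq> 0"
proof (cases "x = 0 \<and> y = 0")
  case True
  then show ?thesis using that[of 1 0] by simp
next
  case False
  then show ?thesis using that[of y "- x"] by (auto simp: mult.commute)
qed

text \<open>
  The element outside the image is a monomial at which the functional is nonzero.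
\<close>

lemma not_surj_mult_linear_form:
  fixes l :: "('n::finite, 'k::field) mpoly_ring"
  assumes "card (UNIV :: 'n set) \<ge> 4" "\<alpha> \<ge> 4" "l \<in> homogeneous_part 1"
  obtains f where "f \<in> homogeneous_part \<alpha>" "\<And>g. f - l * g \<notin> J_ideal \<alpha>"
proof -
  obtain T :: "'n set" where "card T = 4"
    using obtain_subset_with_card_n[OF assms(1)] by blast
  then obtain p q a b :: 'n where distinct: "distinct [p, q, a, b]"
    by (auto simp: numeral_eq_Suc card_Suc_eq)
  obtain c where l: "l = (\<Sum>i\<in>UNIV. Poly_Mapping.single (Poly_Mapping.single i 1) (c i))"
    using linear_form_expansion[OF assms(3)] .
  obtain s t where st: "c p * s + c q * t = 0" "s \<noteq> 0 \<or> t \<noteq> 0"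
    by (rule nontrivial_zero_of_binary_form)
  obtain u v where uv: "c a * u + c b * v = 0" "u \<noteq> 0 \<or> v \<noteq> 0"
    by (rule nontrivial_zero_of_binary_form)
  let ?w = "binary_weight \<alpha> p q a b s t u v"
  obtain p' where p': "p' = p \<and> s \<noteq> 0 \<or> p' = q \<and> t \<noteq> 0"
    using st(2) by blast
  obtain a' where a': "a' = a \<and> u \<noteq> 0 \<or> a' = b \<and> v \<noteq> 0"
    using uv(2) by blast
  define m where "m = Poly_Mapping.single p' 1 + Poly_Mapping.single a' (\<alpha> - 1)"
  have "p' \<noteq> a'"
    using p' a' distinct by auto
  then have "Poly_Mapping.lookup m i = (if i = p' then 1 else if i = a' then \<alpha> - 1 else 0)" for i
    by (simp add: m_def lookup_add lookup_single when_def)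
  moreover have "p \<noteq> q" "p \<noteq> a" "p \<noteq> b" "q \<noteq> a" "q \<noteq> b" "a \<noteq> b"
    "q \<noteq> p" "a \<noteq> p" "b \<noteq> p" "a \<noteq> q" "b \<noteq> q" "b \<noteq> a"
    using distinct by auto
  ultimately have m: "?w m \<noteq> 0"
    using p' a' by (elim disjE) (simp_all add: binary_weight_def)
  have l_zero: "weighted_sum ?w (l * g) = 0" for g
  proof (rule weighted_sum_mult_eq_0)
    fix n and d :: 'k
    have "weighted_sum ?w (l * Poly_Mapping.single n d) =
        d * (\<Sum>i\<in>UNIV. c i * ?w (Poly_Mapping.single i 1 + n))"
      by (simp add: l sum_distrib_right mult_single weighted_sum_sum)
         (simp add: sum_distrib_left mult_ac)
    then show "weighted_sum ?w (l * Poly_Mapping.single n d) = 0"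
      using binary_weight_linear_form[OF distinct st(1) uv(1), of \<alpha> n] by simp
  qed
  show ?thesis
  proof (rule that)
    show "Poly_Mapping.single m 1 \<in> homogeneous_part \<alpha>"
      using assms(2) by (intro single_mem_homogeneous_part) (simp add: m_def total_degree_add)
    fix g
    have "weighted_sum ?w (Poly_Mapping.single m 1) =
        weighted_sum ?w (Poly_Mapping.single m 1 - l * g) + weighted_sum ?w (l * g)"
      by (simp flip: weighted_sum_add)
    then have "weighted_sum ?w (Poly_Mapping.single m 1 - l * g) \<noteq> 0"
      using m l_zero by simp
    then show "Poly_Mapping.single m 1 - l * g \<notin> J_ideal \<alpha>"
      using weighted_sum_J_ideal[of ?w \<alpha>, OF binary_weight_generators[OF assms(2) distinct]]
      by metis
  qed
qed

section \<open>Failure of the weak Lefschetz property\<close>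

theorem theoremC:
  fixes r \<alpha> :: nat
  assumes "infinite (UNIV :: 'k::field set)" and "CHAR('k) = 2"
    and "card (UNIV :: 'n::finite set) = r" and "r \<ge> 4" and "\<alpha> \<ge> 5"
  shows "\<not> weak_Lefschetz (J_ideal \<alpha> :: ('n, 'k) mpoly_ring set)"
proof
  let ?J = "J_ideal \<alpha> :: ('n, 'k) mpoly_ring set"
  interpret poly_ideal ?J
    by (rule poly_ideal_J_ideal)
  assume "weak_Lefschetz ?J"
  then obtain l :: "('n, 'k) mpoly_ring" where l: "l \<in> homogeneous_part 1"
    and max_rank: "\<And>i. i < top_degree ?J \<Longrightarrow>
      inj_on (\<lambda>x. residue_class ?J l \<otimes>\<^bsub>quotient_algebra ?J\<^esub> x) (graded_component ?J i) \<or>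
      (\<lambda>x. residue_class ?J l \<otimes>\<^bsub>quotient_algebra ?J\<^esub> x) ` graded_component ?J i =
        graded_component ?J (i + 1)"
    unfolding weak_Lefschetz_def Let_def by blast
  let ?mult = "\<lambda>x. residue_class ?J l \<otimes>\<^bsub>quotient_algebra ?J\<^esub> x"
  have "\<alpha> \<ge> 2" "\<alpha> \<ge> 4" "card (UNIV :: 'n set) \<ge> 4"
    using assms(3-5) by simp_all
  obtain f where f: "f \<in> homogeneous_part (\<alpha> - 1)" "f \<notin> ?J" "l * f \<in> ?J"
    using not_inj_mult_linear_form[OF assms(2) \<open>\<alpha> \<ge> 2\<close> l] .
  obtain g where g: "g \<in> homogeneous_part \<alpha>" "\<And>h. g - l * h \<notin> ?J"
    using not_surj_mult_linear_form[OF \<open>card (UNIV :: 'n set) \<ge> 4\<close> \<open>\<alpha> \<ge> 4\<close> l] by blast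
  have "g \<notin> ?J"
    using g(2)[of 0] by simp
  then have "\<alpha> - 1 < top_degree ?J"
    using le_top_degree_J_ideal[OF g(1), of \<alpha>] assms(5) by linarith
  note rank = max_rank[OF this]
  have "\<alpha> - 1 + 1 = \<alpha>"
    using assms(5) by linarith
  then consider
      (inj) "inj_on ?mult (graded_component ?J (\<alpha> - 1))"
    | (surj) "?mult ` graded_component ?J (\<alpha> - 1) = graded_component ?J \<alpha>"
    using rank by force
  then show False
  proof cases
    case inj
    have "(0 :: ('n, 'k) mpoly_ring) \<in> homogeneous_part (\<alpha> - 1)"
      by (simp add: mem_homogeneous_part)
    then have "residue_class ?J f \<in> graded_component ?J (\<alpha> - 1)"
      "residue_class ?J 0 \<in> graded_component ?J (\<alpha> - 1)"
      using f(1) unfolding graded_component_def by (blast intro: imageI)+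
    moreover have "?mult (residue_class ?J f) = ?mult (residue_class ?J 0)"
      using f(3) by (simp add: residue_class_mult residue_class_eq_iff)
    ultimately have "residue_class ?J f = residue_class ?J 0"
      using inj_onD[OF inj] by metis
    then show False
      using f(2) by (simp add: residue_class_eq_iff)
  next
    case surj
    have "residue_class ?J g \<in> ?mult ` graded_component ?J (\<alpha> - 1)"
      using g(1) unfolding surj by (simp add: graded_component_def)
    then obtain h where "residue_class ?J g = residue_class ?J (l * h)"
      by (auto simp: graded_component_def residue_class_mult)
    then show False
      using g(2) by (simp add: residue_class_eq_iff)
  qed
qed

end
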